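(* Let $\theta\ge0$, $0\le\alpha<n$, $1\le p<\infty$ and $p\le q<\infty$. Let $\mu,\nu$ be weights on $\mathbb{R}^n$ and $\rho$ a critical radius function. Then there is a constant $c>0$ such that $$\|M_\alpha^{\rho,\theta}f\|_{L^{q,\infty}(\nu)}\le c\|f\|_{L^{p,1}(\mu)}\quad\text{for every measurable function } f$$ if and only if $(\mu,\nu)\in A_{p,q,\alpha}^{\rho,\theta,\mathcal{R}}$. Moreover, if $(\mu,\nu)\in A_{p,q,\alpha}^{\rho,\theta,\mathcal{R}}$, then for every measurable $f$ $$\|M_\alpha^{\rho,\theta}f\|_{L^{q,\infty}(\nu)}\le C\,[\mu,\nu]_{A_{p,q,\alpha}^{\rho,\theta,\mathcal{R}}}\|f\|_{L^{p,1}(\mu)},$$ where $C>0$ does not depend on $f,\mu,\nu$.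
   Context: A critical radius function is $\rho:\mathbb{R}^n\to(0,\infty)$ for which there are $C_0,N_0>0$ with $C_0^{-1}\rho(x)(1+\frac{|x-y|}{\rho(x)})^{-N_0}\le\rho(y)\le C_0\rho(x)(1+\frac{|x-y|}{\rho(x)})^{N_0/(N_0+1)}$ for all $x,y\in\mathbb{R}^n$. For a cube $Q$ with center $x_Q$ and side-length $r_Q$, $\psi_\theta(Q)=(1+r_Q/\rho(x_Q))^\theta$. The maximal function is $$M_\alpha^{\rho,\theta}f(x)=\sup_{Q\ni x}\frac1{(\psi_\theta(Q)|Q|)^{1-\alpha/n}}\int_Q|f(y)|\,dy,$$ the supremum over all cubes $Q$ containing $x$. A weight is a locally integrable function with values in $(0,\infty)$ a.e.; $\nu(E)=\int_E\nu$. Lorentz quasi-norms: $\|f\|_{L^{p,1}(\mu)}=p\int_0^\infty\mu(\{|f|>y\})^{1/p}\,dy$, $\|f\|_{L^{q,\infty}(\nu)}=\sup_{y>0}y\,\nu(\{|f|>y\})^{1/q}$, and $L^{\infty,\infty}(\mu)=L^\infty(\mu)$. With $1/p+1/p'=1$, $(\mu,\nu)\in A_{p,q,\alpha}^{\rho,\theta,\mathcal{R}}$ means $$[\mu,\nu]_{A_{p,q,\alpha}^{\rho,\theta,\mathcal{R}}}:=\sup_Q\nu(Q)^{1/q}\,\frac{\|\chi_Q\mu^{-1}\|_{L^{p',\infty}(\mu)}}{(|Q|\psi_\theta(Q))^{1-\alpha/n}}<\infty,$$ the supremum over all cubes $Q\subseteq\mathbb{R}^n$. *)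

theory Defs
  imports "HOL-Analysis.Analysis" "HOL-Probability.Essential_Supremum"
begin

definition critical_radius :: "(real^'n \<Rightarrow> real) \<Rightarrow> bool" where
  "critical_radius \<rho> \<longleftrightarrow> (\<forall>x. 0 < \<rho> x) \<and>
     (\<exists>C0>0. \<exists>N0>0. \<forall>x y.
        inverse C0 * \<rho> x * (1 + norm (x - y) / \<rho> x) powr (- N0) \<le> \<rho> y \<and>
        \<rho> y \<le> C0 * \<rho> x * (1 + norm (x - y) / \<rho> x) powr (N0 / (N0 + 1)))"

text \<open>Cubes are closed, with sides parallel to the coordinate axes. Suprema over cubes are taken
  over the pairs (centre, side length) with positive side length.\<close>

definition cube :: "real^'n \<Rightarrow> real \<Rightarrow> (real^'n) set" where
  "cube c r = cbox (\<chi> i. c $ i - r / 2) (\<chi> i. c $ i + r / 2)"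

definition psi :: "(real^'n \<Rightarrow> real) \<Rightarrow> real \<Rightarrow> real^'n \<Rightarrow> real \<Rightarrow> real" where
  "psi \<rho> \<theta> c r = (1 + r / \<rho> c) powr \<theta>"

definition scaled_size :: "(real^'n \<Rightarrow> real) \<Rightarrow> real \<Rightarrow> real \<Rightarrow> real^'n \<Rightarrow> real \<Rightarrow> real" where
  "scaled_size \<rho> \<theta> \<alpha> c r =
     (psi \<rho> \<theta> c r * measure lebesgue (cube c r)) powr (1 - \<alpha> / real CARD('n))"

definition frac_maximal ::
    "(real^'n \<Rightarrow> real) \<Rightarrow> real \<Rightarrow> real \<Rightarrow> (real^'n \<Rightarrow> real) \<Rightarrow> real^'n \<Rightarrow> ennreal" where
  "frac_maximal \<rho> \<theta> \<alpha> f x =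
     (SUP (c, r) \<in> {(c, r). 0 < r \<and> x \<in> cube c r}.
        (\<integral>\<^sup>+ y \<in> cube c r. ennreal \<bar>f y\<bar> \<partial>lebesgue) / ennreal (scaled_size \<rho> \<theta> \<alpha> c r))"

definition weight :: "(real^'n \<Rightarrow> real) \<Rightarrow> bool" where
  "weight w \<longleftrightarrow> w \<in> borel_measurable lebesgue \<and> (AE x in lebesgue. 0 < w x) \<and>
     (\<forall>K. compact K \<longrightarrow> set_integrable lebesgue K w)"

definition weighted :: "(real^'n \<Rightarrow> real) \<Rightarrow> (real^'n) measure" where
  "weighted w = density lebesgue (\<lambda>x. ennreal (w x))"

text \<open>Real powers of extended nonnegative numbers; only used with exponent \<open>a > 0\<close>.\<close>

definition epowr :: "ennreal \<Rightarrow> real \<Rightarrow> ennreal" where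
  "epowr x a = (if x = \<infinity> then \<infinity> else ennreal (enn2real x powr a))"

text \<open>The Lorentz quasi-norms take the function of absolute values, as the maximal function may
  be infinite.\<close>

definition lorentz_1 :: "real \<Rightarrow> 'a measure \<Rightarrow> ('a \<Rightarrow> ennreal) \<Rightarrow> ennreal" where
  "lorentz_1 p M g =
     ennreal p * (\<integral>\<^sup>+ y \<in> {0<..}. epowr (emeasure M {x \<in> space M. ennreal y < g x}) (1 / p) \<partial>lborel)"

definition lorentz_weak :: "ennreal \<Rightarrow> 'a measure \<Rightarrow> ('a \<Rightarrow> ennreal) \<Rightarrow> ennreal" where
  "lorentz_weak q M g =
     (if q = \<infinity> then esssup M g
      else (SUP y \<in> {0<..}. ennreal y *
              epowr (emeasure M {x \<in> space M. ennreal y < g x}) (1 / enn2real q)))"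

definition conj_exponent :: "real \<Rightarrow> ennreal" where
  "conj_exponent p = inverse (1 - inverse (ennreal p))"

lemma inverse_conj_exponent:
  assumes "1 \<le> p"
  shows "inverse (ennreal p) + inverse (conj_exponent p) = 1"
proof -
  have a: "inverse (ennreal p) = ennreal (1 / p)"
    using assms by (simp add: inverse_ennreal inverse_eq_divide)
  have b: "1 - inverse (ennreal p) = ennreal (1 - 1 / p)"
    unfolding a using assms by (metis ennreal_1 ennreal_minus zero_le_divide_1_iff order_trans zero_le_one)
  have c: "inverse (conj_exponent p) = ennreal (1 - 1 / p)"
  proof (cases "p = 1")
    case False
    then have "0 < 1 - 1 / p" using assms by simp
    then show ?thesis unfolding conj_exponent_def b by (simp add: inverse_ennreal)
  qed (simp add: conj_exponent_def)
  show ?thesis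
    unfolding a c using assms by (simp add: ennreal_plus[symmetric] del: ennreal_plus)
qed

definition A_const ::
    "(real^'n \<Rightarrow> real) \<Rightarrow> real \<Rightarrow> real \<Rightarrow> real \<Rightarrow> real \<Rightarrow> (real^'n \<Rightarrow> real) \<Rightarrow> (real^'n \<Rightarrow> real) \<Rightarrow> ennreal" where
  "A_const \<rho> \<theta> \<alpha> p q \<mu> \<nu> =
     (SUP (c, r) \<in> {(c, r). 0 < r}.
        epowr (emeasure (weighted \<nu>) (cube c r)) (1 / q) *
        (lorentz_weak (conj_exponent p) (weighted \<mu>) (\<lambda>x. ennreal (indicator (cube c r) x * inverse (\<mu> x)))
           / ennreal (scaled_size \<rho> \<theta> \<alpha> c r)))"

definition A_class ::
    "(real^'n \<Rightarrow> real) \<Rightarrow> real \<Rightarrow> real \<Rightarrow> real \<Rightarrow> real \<Rightarrow> ((real^'n \<Rightarrow> real) \<times> (real^'n \<Rightarrow> real)) set" where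
  "A_class \<rho> \<theta> \<alpha> p q = {(\<mu>, \<nu>). A_const \<rho> \<theta> \<alpha> p q \<mu> \<nu> < \<infinity>}"

end

theory Submission
  imports Defs
begin

text \<open>Testing the weak-type inequality on \<open>\<chi>\<^bsub>F\<^esub>\<close> for the superlevel sets \<open>F\<close> of \<open>\<chi>\<^bsub>Q\<^esub> \<mu>\<inverse>\<close> gives the
  bound on \<open>[\<mu>, \<nu>]\<close>. Conversely, if the average over a cube \<open>Q\<close> exceeds \<open>y\<close>, then Hoelder's inequality for
  Lorentz norms with respect to \<open>\<mu>\<close>, combined with the condition on the cube \<open>4Q\<close>, yields
  \<open>y \<nu>(4Q)\<^sup>1\<^sup>/\<^sup>q \<le> C [\<mu>, \<nu>] \<parallel>f \<chi>\<^bsub>Q\<^esub>\<parallel>\<close>; enlarging a cube about its centre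
  changes \<open>\<psi>\<^sub>\<theta>\<close> only by a constant factor. A compact part of the superlevel set of the maximal function is covered
  by the enlargements \<open>4Q\<close> of finitely many disjoint cubes \<open>Q\<close>, and for \<open>q \<ge> p\<close> the powers
  \<open>\<parallel>f \<chi>\<^bsub>Q\<^esub>\<parallel>\<^sup>q\<close> of the norms in \<open>L\<^sup>p\<^sup>,\<^sup>1(\<mu>)\<close> sum up to at most \<open>\<parallel>f\<parallel>\<^sup>q\<close>.\<close>

section \<open>Powers of extended nonnegative numbers\<close>

lemma epowr_ennreal: "0 \<le> x \<Longrightarrow> epowr (ennreal x) a = ennreal (x powr a)"
  by (simp add: epowr_def)

lemma epowr_top [simp]: "epowr top a = top"
  by (simp add: epowr_def)

lemma epowr_zero [simp]: "epowr 0 a = 0"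
  by (simp add: epowr_def)

lemma epowr_eq_top_iff [simp]: "epowr x a = top \<longleftrightarrow> x = top"
  by (simp add: epowr_def)

lemma epowr_eq_zero_iff [simp]: "epowr x a = 0 \<longleftrightarrow> x = 0"
  by (cases x) (auto simp: epowr_ennreal)

lemma epowr_one [simp]: "epowr x 1 = x"
  by (cases x) (auto simp: epowr_ennreal)

lemma epowr_mono:
  assumes "0 \<le> a" "x \<le> y"
  shows "epowr x a \<le> epowr y a"
proof (cases "y = top")
  case False
  then have "x \<noteq> top" using assms(2) by (auto simp: top_unique)
  then show ?thesis
    using False assms by (cases x; cases y) (auto simp: epowr_ennreal intro!: ennreal_leI powr_mono2)
qed simp

lemma epowr_mult:
  assumes "0 < a"
  shows "epowr (x * y) a = epowr x a * epowr y a"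
proof (cases "x = top \<or> y = top")
  case True
  then show ?thesis
    by (auto simp: ennreal_top_mult ennreal_mult_top)
next
  case False
  then show ?thesis
    by (cases x; cases y)
      (auto simp: epowr_ennreal powr_mult simp flip: ennreal_mult)
qed

lemma epowr_epowr: "epowr (epowr x a) b = epowr x (a * b)"
  by (cases x) (auto simp: epowr_ennreal powr_powr)

section \<open>Hoelder's inequality for Lorentz norms\<close>

lemma sigma_finite_lebesgue: "sigma_finite_measure (lebesgue :: 'a::euclidean_space measure)"
proof
  obtain A :: "'a set set" where A: "countable A" "A \<subseteq> sets lborel" "\<Union>A = space lborel"
      "\<forall>a\<in>A. emeasure lborel a \<noteq> \<infinity>"
    using lborel.sigma_finite_countable by blast
  then show "\<exists>A::'a set set. countable A \<and> A \<subseteq> sets lebesgue \<and> \<Union>A = space lebesgue \<and>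
      (\<forall>a\<in>A. emeasure lebesgue a \<noteq> \<infinity>)"
    by (intro exI[of _ A]) (auto simp: subset_iff)
qed

lemma borel_measurable_antimono_real:
  fixes f :: "real \<Rightarrow> 'b::{linorder_topology, second_countable_topology}"
  assumes "antimono f"
  shows "f \<in> borel_measurable borel"
proof (rule borel_measurableI_greater)
  fix y
  have "is_interval {x. y < f x}"
    using antimonoD[OF assms] unfolding is_interval_1 by (auto intro: less_le_trans)
  then show "{x \<in> space borel. y < f x} \<in> sets borel"
    by (simp add: real_interval_borel_measurable)
qed

text \<open>Tonelli's theorem for the region \<open>X\<close> under the graph of \<open>g\<close>:
  slices at fixed \<open>x\<close> give the integral of \<open>g\<close>, slices at fixed height
  \<open>y\<close> give the distribution function.\<close>

lemma (in sigma_finite_measure) nn_integral_layer_cake: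
  assumes g [measurable]: "g \<in> borel_measurable M"
  shows "(\<integral>\<^sup>+ x. g x \<partial>M) = (\<integral>\<^sup>+ y \<in> {0<..}. emeasure M {x \<in> space M. ennreal y < g x} \<partial>lborel)"
proof -
  interpret pair_sigma_finite M "lborel :: real measure"
    by unfold_locales
  define X where "X = {z \<in> space (M \<Otimes>\<^sub>M lborel). 0 < snd z \<and> ennreal (snd z) < g (fst z)}"
  have X: "X \<in> sets (M \<Otimes>\<^sub>M lborel)"
    unfolding X_def by measurable
  have slice: "emeasure lborel (Pair x -` X) = g x" if "x \<in> space M" for x
  proof -
    have eq: "Pair x -` X = {y. 0 < y \<and> ennreal y < g x}"
      using that by (auto simp: X_def space_pair_measure)
    show ?thesis
    proof (cases "g x")
      case (real r)
      then have "Pair x -` X = {0<..<r}"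
        unfolding eq by (auto simp: ennreal_less_iff)
      then show ?thesis using real by simp
    next
      case top
      then have "Pair x -` X = {0<..}" unfolding eq by auto
      moreover have "emeasure lborel {0::real<..} = top"
      proof (rule ccontr)
        assume "emeasure lborel {0::real<..} \<noteq> top"
        then obtain r where r: "emeasure lborel {0::real<..} = ennreal r" "0 \<le> r"
          by (cases "emeasure lborel {0::real<..}") auto
        have "ennreal (r + 1) = emeasure lborel {0<..<r + 1}"
          using r by simp
        also have "\<dots> \<le> ennreal r"
          unfolding r(1)[symmetric] by (intro emeasure_mono) auto
        finally show False
          using r by (simp add: ennreal_le_iff del: ennreal_plus)
      qed
      ultimately show ?thesis using top by simp
    qed
  qed
  have "(\<integral>\<^sup>+ x. g x \<partial>M) = emeasure (M \<Otimes>\<^sub>M lborel) X"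
    using slice by (subst lborel.emeasure_pair_measure_alt[OF X]) (auto intro!: nn_integral_cong)
  also have "\<dots> = (\<integral>\<^sup>+ y \<in> {0<..}. emeasure M {x \<in> space M. ennreal y < g x} \<partial>lborel)"
    by (subst emeasure_pair_measure_alt2[OF X])
      (auto intro!: nn_integral_cong arg_cong2[where f = emeasure] simp: X_def space_pair_measure indicator_def)
  finally show ?thesis .
qed


section \<open>Weak norms with the conjugate exponent\<close>

lemma conj_exponent_1 [simp]: "conj_exponent 1 = \<infinity>"
  by (simp add: conj_exponent_def)

lemma conj_exponent_gt_1:
  assumes "1 < p"
  shows "conj_exponent p = ennreal (p / (p - 1))"
proof -
  have "1 - inverse (ennreal p) = ennreal (1 - 1 / p)"
    using assms by (simp add: inverse_ennreal inverse_eq_divide flip: ennreal_1 ennreal_minus)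
  moreover have "1 - 1 / p = (p - 1) / p" using assms by (simp add: field_simps)
  ultimately show ?thesis
    using assms unfolding conj_exponent_def by (simp add: inverse_ennreal)
qed

lemma lorentz_weak_ennreal:
  assumes "0 \<le> q"
  shows "lorentz_weak (ennreal q) M g =
    (SUP y \<in> {0<..}. ennreal y * epowr (emeasure M {x \<in> space M. ennreal y < g x}) (1 / q))"
  using assms by (simp add: lorentz_weak_def)

lemma lorentz_weak_conj_exponent:
  assumes "1 < p"
  shows "lorentz_weak (conj_exponent p) M g =
    (SUP y \<in> {0<..}. ennreal y * epowr (emeasure M {x \<in> space M. ennreal y < g x}) (1 - 1 / p))"
proof -
  have "1 / (p / (p - 1)) = 1 - 1 / p" using assms by (simp add: field_simps)
  then show ?thesis
    using assms by (simp add: conj_exponent_gt_1 lorentz_weak_ennreal)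
qed

text \<open>Both sides of Hoelder's inequality are reduced by layer cake formulas to this case, where one
  factor is an indicator function. The bounds \<open>D t \<le> m\<close> and \<open>D t \<le> (N / t)\<^sup>b\<close> on the distribution function
  are equal at the threshold \<open>T\<close>.\<close>

lemma (in sigma_finite_measure) nn_integral_le_lorentz_weak:
  assumes h [measurable]: "h \<in> borel_measurable M" and F [measurable]: "F \<in> sets M" and p: "1 \<le> p"
  shows "(\<integral>\<^sup>+ x \<in> F. h x \<partial>M)
    \<le> ennreal p * lorentz_weak (conj_exponent p) M h * epowr (emeasure M F) (1 / p)"
proof (cases "p = 1")
  case True
  have "(\<integral>\<^sup>+ x \<in> F. h x \<partial>M) \<le> (\<integral>\<^sup>+ x \<in> F. esssup M h \<partial>M)"
    using esssup_AE[of h M] by (intro nn_integral_mono_AE) (auto simp: indicator_def elim!: eventually_mono)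
  also have "\<dots> = esssup M h * emeasure M F"
    by (simp add: nn_integral_cmult_indicator)
  finally show ?thesis
    using True by (simp add: lorentz_weak_def)
next
  case False
  with p have p1: "1 < p" by simp
  define N where "N = lorentz_weak (conj_exponent p) M h"
  define m where "m = emeasure M F"
  define D where "D t = emeasure M {x \<in> space M. ennreal t < h x * indicator F x}" for t
  define a where "a = 1 - 1 / p"
  define b where "b = p / (p - 1)"
  have ab: "a * b = 1" "0 < a" "1 < b"
    using p1 by (auto simp: a_def b_def field_simps)
  have layer: "(\<integral>\<^sup>+ x \<in> F. h x \<partial>M) = (\<integral>\<^sup>+ t \<in> {0<..}. D t \<partial>lborel)"
    unfolding D_def by (rule nn_integral_layer_cake) measurable
  have D_le_m: "D t \<le> m" for t
    unfolding D_def m_def by (intro emeasure_mono) (auto simp: indicator_def split: if_splits)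
  have D_le_N: "ennreal t * epowr (D t) a \<le> N" if "0 < t" for t
  proof -
    have "epowr (D t) a \<le> epowr (emeasure M {x \<in> space M. ennreal t < h x}) a"
      unfolding D_def using ab
      by (intro epowr_mono emeasure_mono) (auto simp: indicator_def split: if_splits)
    then have "ennreal t * epowr (D t) a \<le> ennreal t * epowr (emeasure M {x \<in> space M. ennreal t < h x}) a"
      by (rule mult_left_mono) simp
    also have "\<dots> \<le> N"
      unfolding N_def lorentz_weak_conj_exponent[OF p1] a_def using that by (intro SUP_upper) auto
    finally show ?thesis .
  qed
  \<comment> \<open>A threshold \<open>T\<close> exists only for finite positive \<open>m\<close>
    and \<open>N\<close>; products with 0 and infinity are settled separately.\<close>
  consider "m = 0 \<or> N = 0" | "m \<noteq> 0" "N \<noteq> 0" "m = top \<or> N = top"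
    | m' n where "m = ennreal m'" "N = ennreal n" "0 < m'" "0 < n"
    by (cases m; cases N) (auto simp: less_le)
  then have "(\<integral>\<^sup>+ t \<in> {0<..}. D t \<partial>lborel) \<le> ennreal p * N * epowr m (1 / p)"
  proof cases
    case 1
    have "D t = 0" if "0 < t" for t
      using 1 D_le_m[of t] D_le_N[OF that] that by auto
    then have "(\<integral>\<^sup>+ t \<in> {0<..}. D t \<partial>lborel) = (\<integral>\<^sup>+ t. 0 \<partial>(lborel :: real measure))"
      by (intro nn_integral_cong) (auto simp: indicator_def)
    then show ?thesis by simp
  next
    case 2
    then have "ennreal p * N * epowr m (1 / p) = top"
      using p1 by (auto simp: ennreal_mult_eq_top_iff)
    then show ?thesis by simp
  next
    case 3
    define T where "T = n * m' powr (- a)"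
    have T: "0 < T" using 3 by (simp add: T_def)
    define S where "S t = n powr b * t powr (- b)" for t :: real
    \<comment> \<open>Raising \<open>D_le_N\<close> to the power \<open>b\<close> isolates
      \<open>D t\<close>, since \<open>a * b = 1\<close>.\<close>
    have D_le_S: "D t \<le> ennreal (S t)" if "0 < t" for t
    proof -
      have "epowr (ennreal t * epowr (D t) a) b \<le> epowr N b"
        using D_le_N[OF that] ab by (intro epowr_mono) auto
      then have "ennreal (t powr b) * D t \<le> ennreal (n powr b)"
        using that 3 ab by (simp add: epowr_mult epowr_epowr epowr_ennreal)
      then have "ennreal (t powr (- b)) * (ennreal (t powr b) * D t) \<le> ennreal (t powr (- b)) * ennreal (n powr b)"
        by (rule mult_left_mono) simp
      moreover have "ennreal (t powr (- b)) * (ennreal (t powr b) * D t) = D t"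
        using that by (simp add: powr_minus flip: mult.assoc ennreal_mult)
      moreover have "ennreal (t powr (- b)) * ennreal (n powr b) = ennreal (S t)"
        by (simp add: S_def mult.commute flip: ennreal_mult)
      ultimately show ?thesis by simp
    qed
    have deriv: "((\<lambda>t. n powr b * t powr (1 - b) / (1 - b)) has_real_derivative S t) (at t)" if "T \<le> t" for t
    proof -
      have "((\<lambda>t. n powr b * t powr (1 - b) / (1 - b)) has_real_derivative
          n powr b * ((1 - b) * t powr (1 - b - 1)) / (1 - b)) (at t)"
        using that T by (intro DERIV_cdivide DERIV_cmult has_real_derivative_powr) auto
      then show ?thesis using ab by (simp add: S_def)
    qed
    have lim: "((\<lambda>t. n powr b * t powr (1 - b) / (1 - b)) \<longlongrightarrow> 0) at_top"
    proof -
      have "((\<lambda>t. t powr (1 - b)) \<longlongrightarrow> 0) at_top"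
        using ab by (intro tendsto_neg_powr filterlim_ident) auto
      from tendsto_divide[OF tendsto_mult_left[OF this, of "n powr b"] tendsto_const[of "1 - b"]]
      show ?thesis using ab by simp
    qed
    \<comment> \<open>Below \<open>T\<close> the bound \<open>m\<close> is used, from
      \<open>T\<close> on the bound \<open>S\<close>, which is integrable at infinity because
      \<open>1 < b\<close>. The two parts contribute 1 and \<open>p - 1\<close> times
      \<open>n * m' powr (1 / p)\<close>, whence the factor \<open>p\<close>.\<close>
    have "(\<integral>\<^sup>+ t \<in> {0<..}. D t \<partial>lborel)
        \<le> (\<integral>\<^sup>+ t. m * indicator {0<..<T} t + ennreal (S t) * indicator {T..} t \<partial>lborel)"
      using D_le_m D_le_S T by (intro nn_integral_mono) (auto simp: indicator_def)
    also have "\<dots> = m * ennreal T + (\<integral>\<^sup>+ t. ennreal (S t) * indicator {T..} t \<partial>lborel)"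
      using T by (subst nn_integral_add) (auto simp: nn_integral_cmult_indicator S_def)
    also have "(\<integral>\<^sup>+ t. ennreal (S t) * indicator {T..} t \<partial>lborel)
        = ennreal (0 - n powr b * T powr (1 - b) / (1 - b))"
      by (rule nn_integral_FTC_atLeast[OF _ deriv _ lim]) (auto simp: S_def)
    also have "0 - n powr b * T powr (1 - b) / (1 - b) = (p - 1) * (n * m' powr (1 / p))"
    proof -
      have "- a * (1 - b) = a * b - a" by (simp add: algebra_simps)
      also have "\<dots> = 1 / p" using ab(1) by (simp add: a_def)
      finally have "(m' powr (- a)) powr (1 - b) = m' powr (1 / p)"
        by (simp only: powr_powr)
      then have "T powr (1 - b) = n powr (1 - b) * m' powr (1 / p)"
        using 3 by (simp add: T_def powr_mult)
      moreover have "n powr b * n powr (1 - b) = n" using 3 by (simp flip: powr_add)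
      ultimately have eq: "n powr b * T powr (1 - b) = n * m' powr (1 / p)"
        by (simp flip: mult.assoc)
      have "0 - c / (1 - b) = (p - 1) * c" for c
        using p1 by (simp add: b_def divide_simps)
      then show ?thesis unfolding eq .
    qed
    also have "m * ennreal T = ennreal (n * m' powr (1 / p))"
    proof -
      have "m' * T = n * (m' powr 1 * m' powr (- a))" using 3 by (simp add: T_def)
      also have "m' powr 1 * m' powr (- a) = m' powr (1 / p)"
        unfolding powr_add[symmetric] by (simp add: a_def)
      finally show ?thesis using 3 T by (simp flip: ennreal_mult)
    qed
    also have "ennreal (n * m' powr (1 / p)) + ennreal ((p - 1) * (n * m' powr (1 / p)))
        = ennreal p * N * epowr m (1 / p)"
      using 3 p1 by (simp add: epowr_ennreal flip: ennreal_mult ennreal_plus) (simp add: algebra_simps)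
    finally show ?thesis .
  qed
  then show ?thesis
    unfolding layer N_def m_def .
qed

section \<open>Lorentz norms over disjoint sets\<close>

text \<open>Hoelder's inequality for finite sums. After division of \<open>m\<close> by
  \<open>M\<close>, Young's inequality bounds each term by a convex combination of
  \<open>w i\<close> and \<open>m i / M\<close>, and these add up to at most 1.\<close>

lemma sum_powr_mult_powr_le:
  fixes w m :: "'i \<Rightarrow> real"
  assumes "finite I" "1 \<le> p" and w: "\<And>i. i \<in> I \<Longrightarrow> 0 \<le> w i" and m: "\<And>i. i \<in> I \<Longrightarrow> 0 \<le> m i"
    and sums: "(\<Sum>i\<in>I. w i) \<le> 1" "(\<Sum>i\<in>I. m i) \<le> M"
  shows "(\<Sum>i\<in>I. w i powr (1 - 1 / p) * m i powr (1 / p)) \<le> M powr (1 / p)"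
proof (cases "M > 0")
  case True
  have "w i powr (1 - 1 / p) * (m i / M) powr (1 / p) \<le> (1 - 1 / p) * w i + (1 / p) * (m i / M)"
    if "i \<in> I" for i
  \<comment> \<open>Young's inequality is applied to positive numbers; otherwise the left side is 0,
    as \<open>0 powr a = 0\<close> for every \<open>a\<close>.\<close>
  proof (cases "w i = 0 \<or> m i = 0")
    case True
    then show ?thesis using w[OF that] m[OF that] \<open>0 < M\<close> \<open>1 \<le> p\<close> by auto
  next
    case False
    then show ?thesis
      using w[OF that] m[OF that] \<open>0 < M\<close> \<open>1 \<le> p\<close> by (intro Youngs_inequality_0) auto
  qed
  then have "(\<Sum>i\<in>I. w i powr (1 - 1 / p) * (m i / M) powr (1 / p))
      \<le> (1 - 1 / p) * (\<Sum>i\<in>I. w i) + (1 / p) * ((\<Sum>i\<in>I. m i) / M)"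
    by (simp add: sum_distrib_left sum_divide_distrib sum.distrib[symmetric] sum_mono)
  also have "\<dots> \<le> (1 - 1 / p) * 1 + (1 / p) * 1"
    using sums True \<open>1 \<le> p\<close> by (intro add_mono mult_left_mono) auto
  also have "\<dots> = 1" by simp
  finally have le1: "(\<Sum>i\<in>I. w i powr (1 - 1 / p) * (m i / M) powr (1 / p)) \<le> 1" .
  have "(\<Sum>i\<in>I. w i powr (1 - 1 / p) * m i powr (1 / p))
      = M powr (1 / p) * (\<Sum>i\<in>I. w i powr (1 - 1 / p) * (m i / M) powr (1 / p))"
    using True m by (simp add: sum_distrib_left powr_divide cong: sum.cong)
  also have "\<dots> \<le> M powr (1 / p) * 1"
    using le1 by (intro mult_left_mono) auto
  finally show ?thesis by simp
next
  case False
  then have "(\<Sum>i\<in>I. m i) = 0"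
    using sums m by (meson antisym not_less order_trans sum_nonneg)
  then have "\<forall>i\<in>I. m i = 0"
    using m \<open>finite I\<close> by (simp add: sum_nonneg_eq_0_iff)
  then show ?thesis by simp
qed

lemma sum_powr_mult_epowr_le:
  fixes w :: "'i \<Rightarrow> real" and m :: "'i \<Rightarrow> ennreal"
  assumes "finite I" "1 \<le> p" and w: "\<And>i. i \<in> I \<Longrightarrow> 0 \<le> w i"
    and sums: "(\<Sum>i\<in>I. w i) \<le> 1" "(\<Sum>i\<in>I. m i) \<le> M"
  shows "(\<Sum>i\<in>I. ennreal (w i powr (1 - 1 / p)) * epowr (m i) (1 / p)) \<le> epowr M (1 / p)"
proof (cases M)
  case (real M')
  define m' where "m' i = enn2real (m i)" for i
  have m: "m i = ennreal (m' i)" "0 \<le> m' i" if "i \<in> I" for i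
  proof -
    have "m i \<le> (\<Sum>i\<in>I. m i)" using that \<open>finite I\<close> by (intro member_le_sum) auto
    also have "\<dots> < top" using sums(2) real by (auto simp: le_less_trans)
    finally show "m i = ennreal (m' i)" "0 \<le> m' i" by (simp_all add: m'_def)
  qed
  have "(\<Sum>i\<in>I. m i) = ennreal (\<Sum>i\<in>I. m' i)"
    using m by (simp cong: sum.cong)
  then have le: "(\<Sum>i\<in>I. m' i) \<le> M'"
    using sums(2) real by simp
  have "(\<Sum>i\<in>I. ennreal (w i powr (1 - 1 / p)) * epowr (m i) (1 / p))
      = ennreal (\<Sum>i\<in>I. w i powr (1 - 1 / p) * m' i powr (1 / p))"
    using m by (simp add: epowr_ennreal ennreal_mult sum_nonneg flip: sum_ennreal cong: sum.cong)
  also have "\<dots> \<le> ennreal (M' powr (1 / p))"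
    using assms m le by (intro ennreal_leI sum_powr_mult_powr_le) auto
  finally show ?thesis using real by (simp add: epowr_ennreal)
qed simp

text \<open>Distribution functions decrease in the level, hence are Borel. This permits linear
  operations under the integral in \<open>lorentz_1\<close>.\<close>

lemma borel_measurable_distribution [measurable]:
  assumes "g \<in> borel_measurable M" "0 \<le> a"
  shows "(\<lambda>y::real. epowr (emeasure M {x \<in> space M. ennreal y < g x}) a) \<in> borel_measurable borel"
proof (rule borel_measurable_antimono_real, rule antimonoI)
  fix y z :: real assume "y \<le> z"
  then show "epowr (emeasure M {x \<in> space M. ennreal z < g x}) a
      \<le> epowr (emeasure M {x \<in> space M. ennreal y < g x}) a"
    using assms by (intro epowr_mono emeasure_mono) (auto intro: le_less_trans ennreal_leI)
qed

lemma lorentz_1_mono: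
  assumes "0 \<le> p" "g \<in> borel_measurable M" "\<And>x. x \<in> space M \<Longrightarrow> f x \<le> g x"
  shows "lorentz_1 p M f \<le> lorentz_1 p M g"
  unfolding lorentz_1_def
proof (intro mult_left_mono nn_integral_mono mult_right_mono epowr_mono emeasure_mono)
  show "{x \<in> space M. ennreal y < f x} \<subseteq> {x \<in> space M. ennreal y < g x}" for y
    using assms(3) by (auto intro: less_le_trans)
qed (use assms in auto)

text \<open>For the exponent \<open>p\<close>, the norms are combined with weights \<open>w\<close>
  into one integral over the level \<open>y\<close>. At each level the distribution functions of the
  pieces add up to at most that of \<open>g\<close>, so Hoelder's inequality for sums applies. The
  exponent \<open>q\<close> follows because each piece has norm at most \<open>L\<close>.\<close>

lemma sum_lorentz_1_indicator_le:
  assumes p: "1 \<le> p" and q: "p \<le> q" and I: "finite I" and disj: "disjoint_family_on Q I"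
    and Q [measurable]: "\<And>i. i \<in> I \<Longrightarrow> Q i \<in> sets M"
    and g [measurable]: "g \<in> borel_measurable M"
  shows "(\<Sum>i\<in>I. epowr (lorentz_1 p M (\<lambda>x. g x * indicator (Q i) x)) q)
    \<le> epowr (lorentz_1 p M g) q"
proof (cases "lorentz_1 p M g")
  case top
  then show ?thesis by simp
next
  case (real L)
  define h where "h i x = g x * indicator (Q i) x" for i x
  have h [measurable]: "h i \<in> borel_measurable M" if "i \<in> I" for i
    unfolding h_def using that by measurable
  define l where "l i = enn2real (lorentz_1 p M (h i))" for i
  have h_le: "lorentz_1 p M (h i) \<le> ennreal L" if "i \<in> I" for i
    unfolding real(2)[symmetric] using p by (intro lorentz_1_mono) (auto simp: h_def indicator_def)
  have l: "lorentz_1 p M (h i) = ennreal (l i)" "0 \<le> l i" if "i \<in> I" for i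
    using h_le[OF that] by (auto simp: l_def le_less_trans)
  have l_le: "l i \<le> L" if "i \<in> I" for i
    using h_le[OF that] l[OF that] real(1) by simp
  define S where "S = (\<Sum>i\<in>I. l i powr p)"
  have S_nonneg: "0 \<le> S" by (simp add: S_def sum_nonneg)
  have S_le: "S \<le> L powr p"
  proof (cases "S = 0")
    case False
    with S_nonneg have S: "0 < S" by simp
    \<comment> \<open>the weights giving equality in Hoelder's inequality for the sequence \<open>l\<close>\<close>
    define w where "w i = l i powr p / S" for i
    have w: "0 \<le> w i" for i using S by (simp add: w_def)
    have sum_w: "(\<Sum>i\<in>I. w i) = 1"
      using S by (simp add: w_def S_def flip: sum_divide_distrib)
    let ?D = "\<lambda>f y. emeasure M {x \<in> space M. ennreal y < f x}"
    have sum_D: "(\<Sum>i\<in>I. ?D (h i) y) \<le> ?D g y" for y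
    proof -
      have "(\<Sum>i\<in>I. ?D (h i) y) = emeasure M (\<Union>i\<in>I. {x \<in> space M. ennreal y < h i x})"
      proof (rule sum_emeasure[OF _ _ I])
        show "disjoint_family_on (\<lambda>i. {x \<in> space M. ennreal y < h i x}) I"
        proof -
          have "{x \<in> space M. ennreal y < h i x} \<subseteq> Q i" for i
            by (auto simp: h_def indicator_def split: if_splits)
          then show ?thesis
            using disj unfolding disjoint_family_on_def by blast
        qed
      qed auto
      also have "\<dots> \<le> ?D g y"
        by (intro emeasure_mono) (auto simp: h_def indicator_def split: if_splits)
      finally show ?thesis .
    qed
    \<comment> \<open>Linearity moves the weighted sum under the integral, where
      \<open>sum_powr_mult_epowr_le\<close> applies pointwise in \<open>y\<close>.\<close>
    have "ennreal (\<Sum>i\<in>I. w i powr (1 - 1 / p) * l i)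
        = (\<Sum>i\<in>I. ennreal (w i powr (1 - 1 / p)) * lorentz_1 p M (h i))"
      using l by (simp add: ennreal_mult sum_nonneg flip: sum_ennreal cong: sum.cong)
    also have "\<dots> = ennreal p * (\<integral>\<^sup>+ y \<in> {0<..}. (\<Sum>i\<in>I. ennreal (w i powr (1 - 1 / p)) * epowr (?D (h i) y) (1 / p)) \<partial>lborel)"
      using p unfolding lorentz_1_def
      by (simp add: sum_distrib_left sum_distrib_right nn_integral_sum nn_integral_cmult mult.assoc mult.left_commute)
    also have "\<dots> \<le> lorentz_1 p M g"
      unfolding lorentz_1_def using p w sum_w sum_D I
      by (intro mult_left_mono nn_integral_mono mult_right_mono sum_powr_mult_epowr_le) auto
    finally have "(\<Sum>i\<in>I. w i powr (1 - 1 / p) * l i) \<le> L"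
      using real by simp
    moreover have "w i powr (1 - 1 / p) * l i = l i powr p / S powr (1 - 1 / p)" if "i \<in> I" for i
    proof (cases "l i = 0")
      case False
      then have "0 < l i" using l(2)[OF that] by simp
      have "p * (1 - 1 / p) + 1 = p" using p by (simp add: algebra_simps)
      then have "l i powr (p * (1 - 1 / p)) * l i = l i powr p"
        using \<open>0 < l i\<close> by (metis powr_add powr_one less_imp_le)
      then show ?thesis using \<open>0 < l i\<close> S by (simp add: w_def powr_divide powr_powr)
    qed (use p in \<open>simp add: w_def\<close>)
    \<comment> \<open>With this choice of \<open>w\<close> the weighted sum collapses to
      \<open>S powr (1 / p)\<close>.\<close>
    ultimately have "S / S powr (1 - 1 / p) \<le> L"
      by (simp add: S_def sum_divide_distrib cong: sum.cong)
    moreover have "S / S powr (1 - 1 / p) = S powr (1 / p)"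
      using S by (simp add: powr_diff)
    ultimately have "(S powr (1 / p)) powr p \<le> L powr p"
      using p by (intro powr_mono2) auto
    then show ?thesis using S p by (simp add: powr_powr)
  qed simp
  \<comment> \<open>The surplus power \<open>q - p\<close> is estimated by \<open>L\<close>, so that
    the bound for the exponent \<open>p\<close> can be summed.\<close>
  have "l i powr q \<le> l i powr p * L powr (q - p)" if "i \<in> I" for i
  proof -
    have "l i powr q = l i powr p * l i powr (q - p)" by (simp flip: powr_add)
    also have "\<dots> \<le> l i powr p * L powr (q - p)"
      using l_le[OF that] l(2)[OF that] q by (intro mult_left_mono powr_mono2) auto
    finally show ?thesis .
  qed
  then have "(\<Sum>i\<in>I. l i powr q) \<le> S * L powr (q - p)"
    unfolding S_def sum_distrib_right by (rule sum_mono)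
  also have "\<dots> \<le> L powr p * L powr (q - p)"
    using S_le by (intro mult_right_mono) auto
  also have "\<dots> = L powr q" by (simp flip: powr_add)
  finally have "ennreal (\<Sum>i\<in>I. l i powr q) \<le> ennreal (L powr q)"
    by (rule ennreal_leI)
  then show ?thesis
    using real l unfolding h_def[symmetric] by (simp add: epowr_ennreal cong: sum.cong)
qed

section \<open>Coverings by cubes\<close>

lemma mem_cube: "x \<in> cube c r \<longleftrightarrow> (\<forall>i. \<bar>x $ i - c $ i\<bar> \<le> r / 2)"
proof -
  have "a - h \<le> y \<and> y \<le> a + h \<longleftrightarrow> \<bar>y - a\<bar> \<le> h" for a h y :: real
    by linarith
  then show ?thesis
    by (simp add: cube_def mem_box_cart)
qed

lemma cube_measurable [measurable, simp]: "cube c r \<in> sets lebesgue"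
  by (simp add: cube_def)

lemma compact_cube: "compact (cube c r)"
  by (simp add: cube_def)

lemma measure_cube:
  fixes c :: "real^'n"
  assumes "0 \<le> r"
  shows "measure lebesgue (cube c r) = r ^ CARD('n)"
proof -
  have "c \<in> cube c r" using assms by (simp add: mem_cube)
  then have "cbox (\<chi> i. c $ i - r / 2) (\<chi> i. c $ i + r / 2) \<noteq> {}"
    unfolding cube_def by auto
  then show ?thesis
    unfolding cube_def by (simp add: content_cbox_cart)
qed

lemma cube_mono: "r \<le> s \<Longrightarrow> cube c r \<subseteq> cube c s"
  unfolding mem_cube subset_iff by (meson divide_right_mono order_trans zero_le_numeral)

lemma cube_subset_interior:
  assumes "r < s"
  shows "cube c r \<subseteq> interior (cube c s)"
proof
  fix x assume x: "x \<in> cube c r"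
  have "c $ i - s / 2 < x $ i \<and> x $ i < c $ i + s / 2" for i
  proof -
    have "\<bar>x $ i - c $ i\<bar> \<le> r / 2" using x by (simp add: mem_cube)
    then show ?thesis using assms by linarith
  qed
  then show "x \<in> interior (cube c s)"
    by (simp add: cube_def interior_cbox mem_box_cart)
qed

text \<open>Triangle inequality in each coordinate through a common point \<open>z\<close>: the
  distance to the new centre is at most r + r/2 + r'/2, hence at most 2r', half of the side 4r'.
  Starting from the doubled cube leaves room for an open cover.\<close>

lemma cube_subset_enlarged:
  assumes "cube c r \<inter> cube c' r' \<noteq> {}" "r \<le> r'"
  shows "cube c (2 * r) \<subseteq> cube c' (4 * r')"
proof
  fix x assume x: "x \<in> cube c (2 * r)"
  obtain z where z: "z \<in> cube c r" "z \<in> cube c' r'" using assms by auto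
  show "x \<in> cube c' (4 * r')"
    unfolding mem_cube
  proof
    fix i
    have "\<bar>x $ i - c $ i\<bar> \<le> r" "\<bar>z $ i - c $ i\<bar> \<le> r / 2" "\<bar>z $ i - c' $ i\<bar> \<le> r' / 2"
      using x z unfolding mem_cube by auto
    then show "\<bar>x $ i - c' $ i\<bar> \<le> 4 * r' / 2"
      using assms(2) by linarith
  qed
qed

text \<open>Greedy Vitali selection: a largest cube is kept, the cubes meeting it are dropped
  because their doubles lie in its fourfold enlargement, and induction treats the remaining
  ones.\<close>

lemma finite_disjoint_cubes:
  assumes "finite F" "\<And>c r. (c, r) \<in> F \<Longrightarrow> 0 < r"
  obtains G where "G \<subseteq> F" "disjoint_family_on (\<lambda>(c, r). cube c r) G"
    "(\<Union>(c, r)\<in>F. cube c (2 * r)) \<subseteq> (\<Union>(c, r)\<in>G. cube c (4 * r))"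
proof -
  have "\<exists>G\<subseteq>F. disjoint_family_on (\<lambda>(c, r). cube c r) G \<and>
    (\<Union>(c, r)\<in>F. cube c (2 * r)) \<subseteq> (\<Union>(c, r)\<in>G. cube c (4 * r))"
    using assms
  proof (induction F rule: finite_psubset_induct)
    case (psubset F)
    show ?case
    proof (cases "F = {}")
      case False
      obtain c r where cr: "(c, r) \<in> F" "\<And>c' r'. (c', r') \<in> F \<Longrightarrow> r' \<le> r"
      proof -
        have fin: "finite (snd ` F)" "snd ` F \<noteq> {}" using psubset(1) False by auto
        then have "Max (snd ` F) \<in> snd ` F" by (rule Max_in)
        then obtain z where z: "z \<in> F" "snd z = Max (snd ` F)" by auto
        show thesis
        proof (rule that[of "fst z" "snd z"])
          show "(fst z, snd z) \<in> F" using z(1) by simp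
          show "r' \<le> snd z" if "(c', r') \<in> F" for c' r'
            unfolding z(2) using fin(1) that by (intro Max_ge) force+
        qed
      qed
      define H where "H = {(c', r') \<in> F. cube c' r' \<inter> cube c r = {}}"
      \<comment> \<open>A positive side length makes the chosen cube nonempty, so it is not disjoint
        from itself and \<open>H\<close> is strictly smaller than \<open>F\<close>.\<close>
      have "c \<in> cube c r" using psubset(3)[OF cr(1)] by (simp add: mem_cube)
      then have "(c, r) \<notin> H" by (auto simp: H_def)
      then have "H \<subset> F" using cr(1) by (auto simp: H_def)
      moreover have "0 < r'" if "(c', r') \<in> H" for c' r'
        using that psubset(3) by (auto simp: H_def)
      ultimately obtain G where G: "G \<subseteq> H" "disjoint_family_on (\<lambda>(c, r). cube c r) G"
          "(\<Union>(c, r)\<in>H. cube c (2 * r)) \<subseteq> (\<Union>(c, r)\<in>G. cube c (4 * r))"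
        using psubset(2)[of H] by blast
      have "insert (c, r) G \<subseteq> F"
        using G(1) \<open>H \<subset> F\<close> cr(1) by auto
      moreover have "disjoint_family_on (\<lambda>(c, r). cube c r) (insert (c, r) G)"
      proof -
        have "cube c r \<inter> cube c' r' = {}" if "(c', r') \<in> G" for c' r'
          using that G(1) by (auto simp: H_def)
        moreover have "(c, r) \<notin> G" using G(1) \<open>(c, r) \<notin> H\<close> by blast
        ultimately show ?thesis using G(2) by (auto simp: disjoint_family_on_insert)
      qed
      moreover have "(\<Union>(c, r)\<in>F. cube c (2 * r)) \<subseteq> (\<Union>(c, r)\<in>insert (c, r) G. cube c (4 * r))"
      proof clarify
        fix x c' r' assume x: "(c', r') \<in> F" "x \<in> cube c' (2 * r')"
        show "x \<in> (\<Union>(c, r)\<in>insert (c, r) G. cube c (4 * r))"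
        proof (cases "(c', r') \<in> H")
          case True
          then show ?thesis using x G(3) by auto
        next
          case False
          then have "cube c' r' \<inter> cube c r \<noteq> {}" using x by (auto simp: H_def)
          then have "x \<in> cube c (4 * r)" using cube_subset_enlarged cr(2)[OF x(1)] x(2) by blast
          then show ?thesis by simp
        qed
      qed
      ultimately show ?thesis by blast
    qed (auto simp: disjoint_family_on_def)
  qed
  then show thesis using that by blast
qed

text \<open>The interiors of the doubled cubes form an open cover. A finite subcover is thinned out
  by the Vitali selection, whose conclusion still covers the doubled cubes.\<close>

lemma compact_disjoint_cubes:
  fixes K :: "(real^'n) set"
  assumes "compact K" "\<And>x. x \<in> K \<Longrightarrow> \<exists>(c, r)\<in>F. x \<in> cube c r" "\<And>c r. (c, r) \<in> F \<Longrightarrow> 0 < r"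
  obtains G where "finite G" "G \<subseteq> F" "disjoint_family_on (\<lambda>(c, r). cube c r) G"
    "K \<subseteq> (\<Union>(c, r)\<in>G. cube c (4 * r))"
proof -
  have "x \<in> (\<Union>z\<in>F. interior (cube (fst z) (2 * snd z)))" if "x \<in> K" for x
  proof -
    from assms(2)[OF that] obtain c r where cr: "(c, r) \<in> F" "x \<in> cube c r" by auto
    have "x \<in> interior (cube c (2 * r))"
      using cube_subset_interior[of r "2 * r" c] cr assms(3)[OF cr(1)] by auto
    then show ?thesis using cr(1) by force
  qed
  then have "K \<subseteq> (\<Union>z\<in>F. interior (cube (fst z) (2 * snd z)))" by blast
  then obtain F' where F': "F' \<subseteq> F" "finite F'" "K \<subseteq> (\<Union>z\<in>F'. interior (cube (fst z) (2 * snd z)))"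
    by (rule compactE_image[OF assms(1), rotated]) (auto simp del: interior_cbox)
  then have K: "K \<subseteq> (\<Union>(c, r)\<in>F'. cube c (2 * r))"
    using interior_subset by (force simp: subset_iff split_beta)
  obtain G where G: "G \<subseteq> F'" "disjoint_family_on (\<lambda>(c, r). cube c r) G"
      "(\<Union>(c, r)\<in>F'. cube c (2 * r)) \<subseteq> (\<Union>(c, r)\<in>G. cube c (4 * r))"
    using finite_disjoint_cubes[OF F'(2)] F'(1) assms(3) by blast
  show thesis
    by (rule that[OF finite_subset[OF G(1) F'(2)] subset_trans[OF G(1) F'(1)] G(2) subset_trans[OF K G(3)]])
qed

section \<open>Scaled sizes of cubes and their enlargements\<close>

lemma scaled_size_pos:
  assumes "0 < \<rho> c" "0 < r"
  shows "0 < scaled_size \<rho> \<theta> \<alpha> c r"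
proof -
  have "0 < 1 + r / \<rho> c" using assms by (intro add_pos_pos divide_pos_pos) auto
  then show ?thesis
    using assms by (simp add: scaled_size_def psi_def measure_cube)
qed

text \<open>The centre is fixed, so the same value \<open>\<rho> c\<close> occurs on both sides and
  1 + 4r / \<open>\<rho> c\<close> is at most 4 (1 + r / \<open>\<rho> c\<close>). The volume grows
  by \<open>4 ^ CARD('n)\<close>, and the bound on \<alpha> makes the outer exponent
  nonnegative.\<close>

lemma scaled_size_enlarged:
  fixes \<rho> :: "real^'n \<Rightarrow> real"
  assumes "0 < \<rho> c" "0 < r" "0 \<le> \<theta>" "\<alpha> \<le> real CARD('n)"
  shows "scaled_size \<rho> \<theta> \<alpha> c (4 * r)
    \<le> (4 powr \<theta> * 4 ^ CARD('n)) powr (1 - \<alpha> / real CARD('n)) * scaled_size \<rho> \<theta> \<alpha> c r"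
proof -
  have pos: "0 < 1 + r / \<rho> c" using assms by (intro add_pos_pos divide_pos_pos) auto
  have "psi \<rho> \<theta> c (4 * r) \<le> (4 * (1 + r / \<rho> c)) powr \<theta>"
    unfolding psi_def using assms pos by (intro powr_mono2) (auto intro: add_nonneg_nonneg)
  also have "\<dots> = 4 powr \<theta> * psi \<rho> \<theta> c r"
    unfolding psi_def using pos by (subst powr_mult) auto
  finally have psi: "psi \<rho> \<theta> c (4 * r) \<le> 4 powr \<theta> * psi \<rho> \<theta> c r" .
  have "psi \<rho> \<theta> c (4 * r) * measure lebesgue (cube c (4 * r))
      \<le> (4 powr \<theta> * psi \<rho> \<theta> c r) * (4 ^ CARD('n) * measure lebesgue (cube c r))"
    using assms psi by (intro mult_mono) (auto simp: measure_cube power_mult_distrib psi_def)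
  then have "scaled_size \<rho> \<theta> \<alpha> c (4 * r)
      \<le> ((4 powr \<theta> * 4 ^ CARD('n)) * (psi \<rho> \<theta> c r * measure lebesgue (cube c r))) powr (1 - \<alpha> / real CARD('n))"
    unfolding scaled_size_def using assms
    by (intro powr_mono2) (auto simp: mult_ac psi_def)
  also have "\<dots> = (4 powr \<theta> * 4 ^ CARD('n)) powr (1 - \<alpha> / real CARD('n)) * scaled_size \<rho> \<theta> \<alpha> c r"
    unfolding scaled_size_def by (subst powr_mult) (auto simp: psi_def)
  finally show ?thesis .
qed

section \<open>Weights\<close>

lemma space_weighted [simp]: "space (weighted w) = UNIV"
  by (simp add: weighted_def)

lemma sets_weighted [measurable_cong, simp]: "sets (weighted w) = sets lebesgue"
  by (simp add: weighted_def)

lemma weight_measurable: "weight w \<Longrightarrow> w \<in> borel_measurable lebesgue"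
  by (simp add: weight_def)

lemma borel_measurable_weighted [simp]: "borel_measurable (weighted w) = borel_measurable lebesgue"
  by (rule measurable_cong_sets) auto

lemma sigma_finite_weighted:
  assumes "weight w"
  shows "sigma_finite_measure (weighted w)"
  using assms unfolding weighted_def
  by (subst sigma_finite_measure.sigma_finite_iff_density_finite[OF sigma_finite_lebesgue])
    (auto simp: weight_def)

lemma emeasure_weighted:
  assumes "weight w" "A \<in> sets lebesgue"
  shows "emeasure (weighted w) A = (\<integral>\<^sup>+ x \<in> A. ennreal (w x) \<partial>lebesgue)"
  using weight_measurable[OF assms(1)] assms(2) unfolding weighted_def by (subst emeasure_density) auto

lemma null_sets_weighted:
  assumes "weight w" "A \<in> null_sets lebesgue"
  shows "A \<in> null_sets (weighted w)"
  using absolutely_continuousI_density[of "\<lambda>x. ennreal (w x)" lebesgue] weight_measurable[OF assms(1)] assms(2)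
  unfolding absolutely_continuous_def weighted_def by auto

lemma emeasure_weighted_compact:
  assumes "weight w" "compact K"
  shows "emeasure (weighted w) K < top"
proof -
  have K: "K \<in> sets lebesgue" using assms(2) by (simp add: borel_compact)
  have int: "integrable lebesgue (\<lambda>x. indicator K x * w x)"
    using assms unfolding weight_def set_integrable_def by auto
  have "emeasure (weighted w) K = (\<integral>\<^sup>+ x \<in> K. ennreal (w x) \<partial>lebesgue)"
    by (rule emeasure_weighted[OF assms(1) K])
  also have "\<dots> \<le> (\<integral>\<^sup>+ x. ennreal (norm (indicator K x * w x)) \<partial>lebesgue)"
    by (intro nn_integral_mono) (auto simp: indicator_def intro!: ennreal_leI)
  also have "\<dots> < top"
    using int unfolding integrable_iff_bounded by (auto simp: less_top)
  finally show ?thesis .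
qed

text \<open>Up to a null set, a Lebesgue measurable set is a countable union of compact sets, and
  Lebesgue null sets are null for the weighted measure. This reduces the weak-type estimate to
  compact sets, which finitely many cubes cover.\<close>

lemma emeasure_weighted_le_compact:
  assumes w: "weight w" and bound: "\<And>K. compact K \<Longrightarrow> K \<subseteq> E \<Longrightarrow> emeasure (weighted w) K \<le> B"
  shows "emeasure (weighted w) E \<le> B"
proof (cases "E \<in> sets lebesgue")
  case True
  then obtain C T where CT: "fsigma C" "T \<in> null_sets lebesgue" "C \<union> T = E"
    using lebesgue_set_almost_fsigma by metis
  then obtain F :: "nat \<Rightarrow> _" where "range F \<subseteq> Collect compact" and F_Un: "C = (\<Union>i. F i)"
    unfolding fsigma_Union_compact by auto
  then have F: "compact (F i)" for i by auto
  have Fm: "F i \<in> sets lebesgue" for i using F by (simp add: borel_compact)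
  \<comment> \<open>Finite unions turn the compact pieces into an increasing sequence, so continuity
    from below applies.\<close>
  define H where "H n = (\<Union>i\<le>n. F i)" for n
  have H: "compact (H n)" "H n \<subseteq> E" "H n \<in> sets lebesgue" for n
    using F F_Un CT(3) Fm unfolding H_def by (auto intro!: compact_UN)
  have "emeasure (weighted w) E = emeasure (weighted w) (C \<union> T)" by (simp add: CT(3))
  also have "\<dots> = emeasure (weighted w) C"
    using Fm null_sets_weighted[OF w CT(2)] by (intro emeasure_Un_null_set) (auto simp: F_Un)
  also have "C = (\<Union>n. H n)" unfolding F_Un H_def by auto
  also have "emeasure (weighted w) (\<Union>n. H n) = (SUP n. emeasure (weighted w) (H n))"
  proof (rule SUP_emeasure_incseq[symmetric])
    show "incseq H" unfolding incseq_def H_def by (intro allI impI UN_mono) auto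
  qed (use H in auto)
  also have "\<dots> \<le> B" using H bound by (intro SUP_least) auto
  finally show ?thesis .
qed (simp add: emeasure_notin_sets)

text \<open>The density \<open>w\<close> cancels against its inverse, as a weight is positive almost
  everywhere. Lebesgue measure thereby becomes an integral for the weighted measure, to which
  Hoelder's inequality applies.\<close>

lemma nn_integral_inverse_weighted:
  assumes w: "weight w" and F [measurable]: "F \<in> sets lebesgue" and "F \<subseteq> Q"
    and Q [measurable]: "Q \<in> sets lebesgue"
  shows "(\<integral>\<^sup>+ x \<in> F. ennreal (indicator Q x * inverse (w x)) \<partial>weighted w) = emeasure lebesgue F"
proof -
  have [measurable]: "w \<in> borel_measurable lebesgue" by (rule weight_measurable[OF w])
  have "(\<integral>\<^sup>+ x \<in> F. ennreal (indicator Q x * inverse (w x)) \<partial>weighted w)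
      = (\<integral>\<^sup>+ x. ennreal (w x) * (ennreal (indicator Q x * inverse (w x)) * indicator F x) \<partial>lebesgue)"
    unfolding weighted_def by (intro nn_integral_density) measurable
  also have "\<dots> = (\<integral>\<^sup>+ x. indicator F x \<partial>lebesgue)"
  proof (rule nn_integral_cong_AE)
    have "AE x in lebesgue. 0 < w x" using w by (simp add: weight_def)
    then show "AE x in lebesgue. ennreal (w x) * (ennreal (indicator Q x * inverse (w x)) * indicator F x)
        = indicator F x"
      by eventually_elim (use \<open>F \<subseteq> Q\<close> in \<open>auto simp: indicator_def simp flip: ennreal_mult\<close>)
  qed
  finally show ?thesis by simp
qed

text \<open>By the layer cake formula it suffices to bound the Lebesgue measure of each superlevel
  set. This is the weighted integral of the inverse weight over that set, so the indicator case of
  Hoelder's inequality applies, and integration over the levels rebuilds \<open>lorentz_1\<close>.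
  The larger set \<open>Q'\<close> allows the weak norm to be taken over an enlarged cube.\<close>

lemma nn_integral_le_lorentz:
  assumes p: "1 \<le> p" and w: "weight w" and f [measurable]: "f \<in> borel_measurable lebesgue"
    and Q [measurable]: "Q \<in> sets lebesgue" "Q' \<in> sets lebesgue" and sub: "Q \<subseteq> Q'"
  shows "(\<integral>\<^sup>+ x \<in> Q. f x \<partial>lebesgue)
    \<le> lorentz_weak (conj_exponent p) (weighted w) (\<lambda>x. ennreal (indicator Q' x * inverse (w x)))
       * lorentz_1 p (weighted w) (\<lambda>x. f x * indicator Q x)"
proof -
  interpret W: sigma_finite_measure "weighted w" by (rule sigma_finite_weighted[OF w])
  have [measurable]: "w \<in> borel_measurable lebesgue" by (rule weight_measurable[OF w])
  define N where "N = lorentz_weak (conj_exponent p) (weighted w) (\<lambda>x. ennreal (indicator Q' x * inverse (w x)))"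
  define S where "S y = {x. ennreal y < f x * indicator Q x}" for y
  have S: "S y \<in> sets lebesgue" for y
  proof -
    have "{x \<in> space lebesgue. ennreal y < f x * indicator Q x} \<in> sets lebesgue" by measurable
    then show ?thesis by (simp add: S_def)
  qed
  have S_sub: "S y \<subseteq> Q'" for y
    using sub by (auto simp: S_def indicator_def split: if_splits)
  have S_le: "emeasure lebesgue (S y) \<le> N * (ennreal p * epowr (emeasure (weighted w) (S y)) (1 / p))" for y
  proof -
    have "emeasure lebesgue (S y) = (\<integral>\<^sup>+ x \<in> S y. ennreal (indicator Q' x * inverse (w x)) \<partial>weighted w)"
      using nn_integral_inverse_weighted[OF w S S_sub] by simp
    also have "\<dots> \<le> ennreal p * N * epowr (emeasure (weighted w) (S y)) (1 / p)"
      unfolding N_def using S p by (intro W.nn_integral_le_lorentz_weak) auto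
    finally show ?thesis by (simp add: ac_simps)
  qed
  have meas: "(\<lambda>y. epowr (emeasure (weighted w) (S y)) (1 / p)) \<in> borel_measurable borel"
    using borel_measurable_distribution[of "\<lambda>x. f x * indicator Q x" "weighted w" "1 / p"] p
    by (simp add: S_def)
  have "(\<integral>\<^sup>+ x \<in> Q. f x \<partial>lebesgue) = (\<integral>\<^sup>+ y \<in> {0<..}. emeasure lebesgue (S y) \<partial>lborel)"
    using sigma_finite_measure.nn_integral_layer_cake[OF sigma_finite_lebesgue, of "\<lambda>x. f x * indicator Q x"]
    by (simp add: S_def)
  also have "\<dots> \<le> (\<integral>\<^sup>+ y. N * (ennreal p * (epowr (emeasure (weighted w) (S y)) (1 / p) * indicator {0<..} y)) \<partial>lborel)"
    using mult_right_mono[OF S_le, of "indicator {0<..} _"] by (intro nn_integral_mono) (auto simp: mult.assoc)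
  also have "\<dots> = N * (ennreal p * (\<integral>\<^sup>+ y \<in> {0<..}. epowr (emeasure (weighted w) (S y)) (1 / p) \<partial>lborel))"
    using meas by (simp add: nn_integral_cmult)
  finally show ?thesis
    unfolding N_def lorentz_1_def S_def by simp
qed

section \<open>The maximal function\<close>

lemma ennreal_less_divide_iff:
  assumes "0 < s" "0 \<le> y"
  shows "ennreal y < I / ennreal s \<longleftrightarrow> ennreal (y * s) < I"
proof (cases I)
  case (real i)
  then show ?thesis using assms by (simp add: divide_ennreal ennreal_less_iff pos_less_divide_eq)
qed (use assms in \<open>simp add: ennreal_top_divide\<close>)

text \<open>Serves to preserve a strict lower bound on an average when the side length grows
  slightly, hence the limit from the right.\<close>

lemma tendsto_scaled_size:
  fixes \<rho> :: "real^'n \<Rightarrow> real"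
  assumes "0 < \<rho> c" "0 < r"
  shows "(scaled_size \<rho> \<theta> \<alpha> c \<longlongrightarrow> scaled_size \<rho> \<theta> \<alpha> c r) (at_right r)"
proof -
  let ?s = "\<lambda>t. ((1 + t / \<rho> c) powr \<theta> * t ^ CARD('n)) powr (1 - \<alpha> / real CARD('n))"
  have pos: "0 < 1 + r / \<rho> c" using assms by (intro add_pos_pos divide_pos_pos) auto
  have eq: "scaled_size \<rho> \<theta> \<alpha> c t = ?s t" if "r \<le> t" for t
    using that assms by (simp add: scaled_size_def psi_def measure_cube)
  have "(?s \<longlongrightarrow> ?s r) (at_right r)"
    using pos assms by (intro tendsto_intros) auto
  moreover have "\<forall>\<^sub>F t in at_right r. ?s t = scaled_size \<rho> \<theta> \<alpha> c t"
    using eventually_at_right_less[of r] by eventually_elim (simp add: eq)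
  ultimately show ?thesis
    unfolding eq[OF order_refl] by (rule Lim_transform_eventually)
qed

text \<open>Enlarging a closed cube slightly keeps the average above \<open>y\<close>. The openness provides the
  measurability needed for the lower bounds, as \<open>emeasure\<close> is \<open>0\<close> on non-measurable sets.\<close>

lemma open_frac_maximal_superlevel:
  fixes \<rho> :: "real^'n \<Rightarrow> real"
  assumes \<rho>: "\<And>x. 0 < \<rho> x" and y: "0 < y"
  shows "open {x. ennreal y < frac_maximal \<rho> \<theta> \<alpha> f x}"
proof (subst open_subopen, intro ballI)
  fix x assume "x \<in> {x. ennreal y < frac_maximal \<rho> \<theta> \<alpha> f x}"
  let ?I = "\<lambda>c r. \<integral>\<^sup>+ y \<in> cube c r. ennreal \<bar>f y\<bar> \<partial>lebesgue"
  obtain c r where cr: "0 < r" "x \<in> cube c r" "ennreal y < ?I c r / ennreal (scaled_size \<rho> \<theta> \<alpha> c r)"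
    using \<open>x \<in> _\<close> unfolding frac_maximal_def by (auto simp: less_SUP_iff)
  then have "ennreal (y * scaled_size \<rho> \<theta> \<alpha> c r) < ?I c r"
    using scaled_size_pos[of \<rho> c r] \<rho> y by (simp add: ennreal_less_divide_iff)
  \<comment> \<open>The integral is kept at side length \<open>r\<close>; only the denominator
    varies with \<open>t\<close>.\<close>
  moreover have "((\<lambda>t. ennreal (y * scaled_size \<rho> \<theta> \<alpha> c t)) \<longlongrightarrow> ennreal (y * scaled_size \<rho> \<theta> \<alpha> c r)) (at_right r)"
    using cr \<rho> by (intro tendsto_ennrealI tendsto_mult_left tendsto_scaled_size)
  ultimately have "\<forall>\<^sub>F t in at_right r. ennreal (y * scaled_size \<rho> \<theta> \<alpha> c t) < ?I c r"
    by (rule order_tendstoD(2)[rotated])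
  then have "\<forall>\<^sub>F t in at_right r. ennreal (y * scaled_size \<rho> \<theta> \<alpha> c t) < ?I c r \<and> r < t"
    by (intro eventually_conj eventually_at_right_less)
  then obtain t where t: "ennreal (y * scaled_size \<rho> \<theta> \<alpha> c t) < ?I c r" "r < t"
    using eventually_happens'[of "at_right r"] by fastforce
  note t(1)
  also have "?I c r \<le> ?I c t"
    using cube_mono[of r t c] t(2) by (intro nn_integral_mono) (auto simp: indicator_def)
  finally have t_less: "ennreal y < ?I c t / ennreal (scaled_size \<rho> \<theta> \<alpha> c t)"
    using scaled_size_pos[of \<rho> c t] \<rho> y cr t(2) by (simp add: ennreal_less_divide_iff)
  \<comment> \<open>The enlarged cube competes in the supremum at each of its points.\<close>
  have "interior (cube c t) \<subseteq> {x. ennreal y < frac_maximal \<rho> \<theta> \<alpha> f x}"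
  proof
    fix z assume "z \<in> interior (cube c t)"
    then have "z \<in> cube c t" using interior_subset by blast
    then have "?I c t / ennreal (scaled_size \<rho> \<theta> \<alpha> c t) \<le> frac_maximal \<rho> \<theta> \<alpha> f z"
      unfolding frac_maximal_def using t(2) cr(1) by (intro SUP_upper2[of "(c, t)"]) auto
    with t_less show "z \<in> {x. ennreal y < frac_maximal \<rho> \<theta> \<alpha> f x}"
      by simp
  qed
  moreover have "x \<in> interior (cube c t)"
    using cube_subset_interior[OF t(2)] cr(2) by blast
  ultimately show "\<exists>T. open T \<and> x \<in> T \<and> T \<subseteq> {x. ennreal y < frac_maximal \<rho> \<theta> \<alpha> f x}"
    using open_interior by blast
qed

section \<open>Sufficiency of the condition on the weights\<close>

lemma A_const_upper:
  assumes "0 < r"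
  shows "epowr (emeasure (weighted \<nu>) (cube c r)) (1 / q) *
      (lorentz_weak (conj_exponent p) (weighted \<mu>) (\<lambda>x. ennreal (indicator (cube c r) x * inverse (\<mu> x)))
        / ennreal (scaled_size \<rho> \<theta> \<alpha> c r)) \<le> A_const \<rho> \<theta> \<alpha> p q \<mu> \<nu>"
  unfolding A_const_def using assms by (intro SUP_upper2[of "(c, r)"]) auto

text \<open>Hoelder's inequality is used with the inverse weight on the enlarged cube, so the
  condition is invoked there and controls its \<nu>-measure, while the norm of \<open>f\<close>
  still sees the small cube alone.\<close>

lemma cube_weight_bound:
  fixes \<rho> :: "real^'n \<Rightarrow> real"
  assumes \<theta>: "0 \<le> \<theta>" and \<alpha>: "\<alpha> \<le> real CARD('n)" and p: "1 \<le> p" and \<rho>: "\<And>x. 0 < \<rho> x"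
    and \<mu>: "weight \<mu>" and f [measurable]: "f \<in> borel_measurable lebesgue" and r: "0 < r"
    and y: "ennreal y < (\<integral>\<^sup>+ x \<in> cube c r. ennreal \<bar>f x\<bar> \<partial>lebesgue) / ennreal (scaled_size \<rho> \<theta> \<alpha> c r)"
  shows "ennreal y * epowr (emeasure (weighted \<nu>) (cube c (4 * r))) (1 / q)
    \<le> ennreal ((4 powr \<theta> * 4 ^ CARD('n)) powr (1 - \<alpha> / real CARD('n))) * A_const \<rho> \<theta> \<alpha> p q \<mu> \<nu>
       * lorentz_1 p (weighted \<mu>) (\<lambda>x. ennreal \<bar>f x\<bar> * indicator (cube c r) x)"
    (is "_ \<le> ennreal ?C * ?A * ?L")
proof -
  define s where "s = scaled_size \<rho> \<theta> \<alpha> c r"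
  define s' where "s' = scaled_size \<rho> \<theta> \<alpha> c (4 * r)"
  define V where "V = epowr (emeasure (weighted \<nu>) (cube c (4 * r))) (1 / q)"
  define N where "N = lorentz_weak (conj_exponent p) (weighted \<mu>)
    (\<lambda>x. ennreal (indicator (cube c (4 * r)) x * inverse (\<mu> x)))"
  have s: "0 < s" "0 < s'" "s' \<le> ?C * s"
    using scaled_size_pos[of \<rho> c] scaled_size_enlarged[of \<rho> c r \<theta> \<alpha>] \<rho> r \<theta> \<alpha> by (auto simp: s_def s'_def)
  have C: "0 < ?C" by simp
  \<comment> \<open>Exchanges the normalisation of the small cube for that of the enlarged
    one.\<close>
  have "1 / s \<le> ?C * (1 / s')"
    using s C by (simp add: field_simps)
  then have s_le: "ennreal (1 / s) \<le> ennreal ?C * ennreal (1 / s')"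
    using C s by (simp flip: ennreal_mult)
  have "(\<integral>\<^sup>+ x \<in> cube c r. ennreal \<bar>f x\<bar> \<partial>lebesgue) \<le> N * ?L"
    unfolding N_def using r cube_mono[of r "4 * r" c] by (intro nn_integral_le_lorentz p \<mu>) auto
  then have "(\<integral>\<^sup>+ x \<in> cube c r. ennreal \<bar>f x\<bar> \<partial>lebesgue) / ennreal s \<le> N * ?L / ennreal s"
    by (rule divide_right_mono_ennreal)
  with y have "ennreal y \<le> N * ?L / ennreal s"
    unfolding s_def by simp
  also have "\<dots> = N * ?L * ennreal (1 / s)"
    using s by (simp add: divide_ennreal_def inverse_ennreal inverse_eq_divide)
  also have "\<dots> \<le> N * ?L * (ennreal ?C * ennreal (1 / s'))"
    using s_le by (rule mult_left_mono) simp
  finally have "ennreal y * V \<le> N * ?L * (ennreal ?C * ennreal (1 / s')) * V"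
    by (rule mult_right_mono) simp
  also have "\<dots> = ennreal ?C * (V * (N / ennreal s')) * ?L"
    using s by (simp add: divide_ennreal_def inverse_ennreal inverse_eq_divide ac_simps)
  also have "\<dots> \<le> ennreal ?C * ?A * ?L"
    using A_const_upper[of "4 * r"] r unfolding V_def N_def s'_def
    by (intro mult_right_mono mult_left_mono) auto
  finally show ?thesis unfolding V_def .
qed

lemma weak_type_bound:
  fixes \<rho> :: "real^'n \<Rightarrow> real"
  assumes \<theta>: "0 \<le> \<theta>" and \<alpha>: "\<alpha> \<le> real CARD('n)" and p: "1 \<le> p" and pq: "p \<le> q"
    and \<rho>: "\<And>x. 0 < \<rho> x" and \<mu>: "weight \<mu>" and \<nu>: "weight \<nu>"
    and f [measurable]: "f \<in> borel_measurable lebesgue"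
  shows "lorentz_weak (ennreal q) (weighted \<nu>) (frac_maximal \<rho> \<theta> \<alpha> f)
    \<le> ennreal ((4 powr \<theta> * 4 ^ CARD('n)) powr (1 - \<alpha> / real CARD('n))) * A_const \<rho> \<theta> \<alpha> p q \<mu> \<nu>
       * lorentz_1 p (weighted \<mu>) (\<lambda>x. ennreal \<bar>f x\<bar>)"
    (is "_ \<le> ?B * ?L")
proof -
  have q: "0 < q" using p pq by simp
  let ?I = "\<lambda>c r. \<integral>\<^sup>+ x \<in> cube c r. ennreal \<bar>f x\<bar> \<partial>lebesgue"
  let ?l = "\<lambda>z. lorentz_1 p (weighted \<mu>) (\<lambda>x. ennreal \<bar>f x\<bar> * indicator (case z of (c, r) \<Rightarrow> cube c r) x)"
  have "ennreal y * epowr (emeasure (weighted \<nu>) {x. ennreal y < frac_maximal \<rho> \<theta> \<alpha> f x}) (1 / q) \<le> ?B * ?L"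
    if y: "0 < y" for y
  proof -
    have cancel: "ennreal y * (ennreal (1 / y) * z) = z" "ennreal (1 / y) * (ennreal y * z) = z" for z
      using y by (simp_all flip: mult.assoc ennreal_mult)
    define F where "F = {(c, r). 0 < r \<and> ennreal y < ?I c r / ennreal (scaled_size \<rho> \<theta> \<alpha> c r)}"
    \<comment> \<open>The desired inequality solved for the \<nu>-measure, with a compact
      \<open>K\<close> in place of the superlevel set.\<close>
    have bound: "emeasure (weighted \<nu>) K \<le> epowr (ennreal (1 / y) * (?B * ?L)) q"
      if K: "compact K" "K \<subseteq> {x. ennreal y < frac_maximal \<rho> \<theta> \<alpha> f x}" for K
    proof -
      have "\<exists>(c, r)\<in>F. x \<in> cube c r" if "x \<in> K" for x
      proof -
        have "ennreal y < frac_maximal \<rho> \<theta> \<alpha> f x" using that K(2) by blast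
        then obtain c r where "0 < r" "x \<in> cube c r" "ennreal y < ?I c r / ennreal (scaled_size \<rho> \<theta> \<alpha> c r)"
          unfolding frac_maximal_def by (auto simp: less_SUP_iff)
        then show ?thesis unfolding F_def by (intro bexI[of _ "(c, r)"]) simp_all
      qed
      moreover have F_pos: "0 < r" if "(c, r) \<in> F" for c r using that by (simp add: F_def)
      ultimately obtain G where G: "finite G" "G \<subseteq> F" "disjoint_family_on (\<lambda>(c, r). cube c r) G"
          "K \<subseteq> (\<Union>(c, r)\<in>G. cube c (4 * r))"
        by (rule compact_disjoint_cubes[OF K(1), of F])
      have cube_bound: "emeasure (weighted \<nu>) (case z of (c, r) \<Rightarrow> cube c (4 * r)) \<le> epowr (ennreal (1 / y) * ?B) q * epowr (?l z) q"
        if "z \<in> G" for z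
      proof -
        obtain c r where z: "z = (c, r)" by (cases z)
        define V where "V = emeasure (weighted \<nu>) (cube c (4 * r))"
        have "(c, r) \<in> F" using that z G(2) by auto
        then have "ennreal y * epowr V (1 / q) \<le> ?B * ?l z"
          using cube_weight_bound[where r = r and y = y and c = c and \<nu> = \<nu> and q = q, OF \<theta> \<alpha> p \<rho> \<mu> f] unfolding F_def V_def z by auto
        then have "ennreal (1 / y) * (ennreal y * epowr V (1 / q)) \<le> ennreal (1 / y) * (?B * ?l z)"
          by (rule mult_left_mono) simp
        then have "epowr V (1 / q) \<le> (ennreal (1 / y) * ?B) * ?l z"
          by (simp only: cancel mult.assoc)
        then have "epowr (epowr V (1 / q)) q \<le> epowr ((ennreal (1 / y) * ?B) * ?l z) q"
          using q by (intro epowr_mono[of q]) auto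
        then show ?thesis
          using q unfolding z V_def by (simp add: epowr_epowr epowr_mult)
      qed
      \<comment> \<open>The enlarged cubes may overlap, so subadditivity is applied to them; the
        norms in \<open>cube_bound\<close> belong to the original cubes, which are disjoint.\<close>
      have "emeasure (weighted \<nu>) K \<le> emeasure (weighted \<nu>) (\<Union>z\<in>G. case z of (c, r) \<Rightarrow> cube c (4 * r))"
        using G by (intro emeasure_mono) (auto intro!: sets.finite_UN)
      also have "\<dots> \<le> (\<Sum>z\<in>G. emeasure (weighted \<nu>) (case z of (c, r) \<Rightarrow> cube c (4 * r)))"
        using G(1) by (intro emeasure_subadditive_finite) auto
      also have "\<dots> \<le> (\<Sum>z\<in>G. epowr (ennreal (1 / y) * ?B) q * epowr (?l z) q)"
        using cube_bound by (rule sum_mono)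
      also have "\<dots> = epowr (ennreal (1 / y) * ?B) q * (\<Sum>z\<in>G. epowr (?l z) q)"
        by (simp add: sum_distrib_left)
      also have "\<dots> \<le> epowr (ennreal (1 / y) * ?B) q * epowr ?L q"
        using G p pq by (intro mult_left_mono sum_lorentz_1_indicator_le) auto
      also have "\<dots> = epowr (ennreal (1 / y) * (?B * ?L)) q"
        using q by (simp add: epowr_mult mult.assoc)
      finally show ?thesis .
    qed
    have "emeasure (weighted \<nu>) {x. ennreal y < frac_maximal \<rho> \<theta> \<alpha> f x} \<le> epowr (ennreal (1 / y) * (?B * ?L)) q"
      by (rule emeasure_weighted_le_compact[OF \<nu> bound])
    then have "epowr (emeasure (weighted \<nu>) {x. ennreal y < frac_maximal \<rho> \<theta> \<alpha> f x}) (1 / q)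
        \<le> epowr (epowr (ennreal (1 / y) * (?B * ?L)) q) (1 / q)"
      using q by (intro epowr_mono[of "1 / q"]) auto
    also have "\<dots> = ennreal (1 / y) * (?B * ?L)"
      using q by (simp add: epowr_epowr)
    finally have "ennreal y * epowr (emeasure (weighted \<nu>) {x. ennreal y < frac_maximal \<rho> \<theta> \<alpha> f x}) (1 / q)
        \<le> ennreal y * (ennreal (1 / y) * (?B * ?L))"
      by (rule mult_left_mono) simp
    then show ?thesis by (simp only: cancel)
  qed
  then show ?thesis
    using q by (auto simp: lorentz_weak_ennreal intro!: SUP_least)
qed

section \<open>Necessity of the condition, by testing on indicator functions\<close>

lemma lorentz_1_indicator:
  assumes "1 \<le> p"
  shows "lorentz_1 p M (\<lambda>x. ennreal \<bar>indicator F x\<bar>) = ennreal p * epowr (emeasure M (F \<inter> space M)) (1 / p)"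
proof -
  have "epowr (emeasure M {x \<in> space M. ennreal y < ennreal \<bar>indicator F x\<bar>}) (1 / p) * indicator {0<..} y
      = epowr (emeasure M (F \<inter> space M)) (1 / p) * indicator {0<..<1} y" for y :: real
  proof -
    \<comment> \<open>The distribution function of an indicator is constant below height 1 and
      vanishes from there on.\<close>
    have "{x \<in> space M. ennreal y < ennreal \<bar>indicator F x\<bar>} = (if y < 1 then F \<inter> space M else {})" if "0 < y"
      using that by (auto simp: indicator_def ennreal_less_iff simp flip: ennreal_1)
    then show ?thesis by (auto simp: indicator_def)
  qed
  then show ?thesis
    unfolding lorentz_1_def by (simp add: nn_integral_cmult_indicator)
qed

text \<open>Gives \<open>p = 1\<close> and \<open>p > 1\<close> a common form that can be tested
  level by level. For \<open>p = 1\<close> the exponent is 0, and every level below the essential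
  supremum is exceeded on a set of positive measure.\<close>

lemma lorentz_weak_conj_exponent_le:
  assumes p: "1 \<le> p" and g: "g \<in> borel_measurable M"
  shows "lorentz_weak (conj_exponent p) M g
    \<le> (SUP t \<in> {0<..}. ennreal t * epowr (emeasure M {x \<in> space M. ennreal t < g x}) (1 - 1 / p))"
    (is "_ \<le> ?S")
proof (cases "p = 1")
  case True
  have "esssup M g \<le> ?S"
  proof (rule dense_le)
    fix y assume y: "y < esssup M g"
    show "y \<le> ?S"
    proof (cases "y = 0")
      case False
      with y obtain t where t: "y = ennreal t" "0 < t"
        by (cases y) auto
      define m where "m = emeasure M {x \<in> space M. ennreal t < g x}"
      have "0 < m" using esssup_pos_measure[OF g y] by (simp add: t m_def)
      \<comment> \<open>Positivity of \<open>m\<close> matters: \<open>epowr 0 0\<close> is 0,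
        because \<open>0 powr 0 = 0\<close>.\<close>
      then have "1 \<le> epowr m 0" by (cases m) (auto simp: epowr_ennreal)
      then have "ennreal t * 1 \<le> ennreal t * epowr m 0" by (rule mult_left_mono) simp
      also have "\<dots> \<le> ?S" using t True unfolding m_def by (intro SUP_upper2[of t]) auto
      finally show ?thesis by (simp add: t)
    qed simp
  qed
  then show ?thesis using True by (simp add: lorentz_weak_def)
next
  case False
  then show ?thesis using p by (simp add: lorentz_weak_conj_exponent)
qed

text \<open>An extended number is the supremum of the numbers strictly below it. Levels strictly
  below an average over a cube are those at which the whole cube lies in the superlevel set of the
  maximal function.\<close>

lemma ennreal_mult_le_dense:
  assumes "\<And>y. 0 < y \<Longrightarrow> ennreal y < z \<Longrightarrow> ennreal y * v \<le> R"
  shows "z * v \<le> (R :: ennreal)"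
proof (cases "v = 0 \<or> R = top")
  case False
  have "z * v = (SUP y \<in> {..<z}. y) * v"
    by (cases "z = 0") (simp_all add: Sup_lessThan bot_ennreal)
  also have "\<dots> = (SUP y \<in> {..<z}. y * v)"
    by (rule SUP_mult_right_ennreal)
  also have "\<dots> \<le> R"
  proof (rule SUP_least)
    fix y assume "y \<in> {..<z}"
    then show "y * v \<le> R" using assms[of "enn2real y"] by (cases y; cases "y = 0") auto
  qed
  finally show ?thesis .
qed auto

lemma weak_type_necessary:
  fixes \<rho> :: "real^'n \<Rightarrow> real"
  assumes p: "1 \<le> p" and pq: "p \<le> q" and \<rho>: "\<And>x. 0 < \<rho> x" and \<mu>: "weight \<mu>" and \<nu>: "weight \<nu>"
    and c: "0 \<le> c"
    and weak: "\<And>f. f \<in> borel_measurable lebesgue \<Longrightarrow>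
      lorentz_weak (ennreal q) (weighted \<nu>) (frac_maximal \<rho> \<theta> \<alpha> f)
        \<le> ennreal c * lorentz_1 p (weighted \<mu>) (\<lambda>x. ennreal \<bar>f x\<bar>)"
  shows "A_const \<rho> \<theta> \<alpha> p q \<mu> \<nu> \<le> ennreal (c * p)"
  unfolding A_const_def
proof (rule SUP_least, clarify)
  fix a :: "real^'n" and r :: real
  assume r: "0 < r"
  define Q where "Q = cube a r"
  define s where "s = scaled_size \<rho> \<theta> \<alpha> a r"
  define V where "V = epowr (emeasure (weighted \<nu>) Q) (1 / q)"
  have q: "0 < q" using p pq by simp
  have s: "0 < s" unfolding s_def using \<rho> r by (intro scaled_size_pos)
  have Q [measurable]: "Q \<in> sets lebesgue" by (simp add: Q_def)
  have [measurable]: "\<mu> \<in> borel_measurable lebesgue" by (rule weight_measurable[OF \<mu>])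
  \<comment> \<open>On all of \<open>Q\<close> the maximal function of the indicator of
    \<open>F\<close> is at least \<open>emeasure lebesgue F / ennreal s\<close>.\<close>
  have test: "emeasure lebesgue F / ennreal s * V \<le> ennreal (c * p) * epowr (emeasure (weighted \<mu>) F) (1 / p)"
    if F [measurable]: "F \<in> sets lebesgue" and FQ: "F \<subseteq> Q" for F
  proof (rule ennreal_mult_le_dense)
    fix y :: real assume y: "0 < y" "ennreal y < emeasure lebesgue F / ennreal s"
    let ?E = "{x. ennreal y < frac_maximal \<rho> \<theta> \<alpha> (indicator F) x}"
    have "(\<integral>\<^sup>+ x \<in> Q. ennreal \<bar>indicator F x\<bar> \<partial>lebesgue) = (\<integral>\<^sup>+ x. indicator F x \<partial>lebesgue)"
      using FQ by (intro nn_integral_cong) (auto simp: indicator_def)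
    also have "\<dots> = emeasure lebesgue F" by simp
    finally have int: "(\<integral>\<^sup>+ x \<in> Q. ennreal \<bar>indicator F x\<bar> \<partial>lebesgue) = emeasure lebesgue F" .
    have "Q \<subseteq> ?E"
    proof
      fix x assume "x \<in> Q"
      then have "emeasure lebesgue F / ennreal s \<le> frac_maximal \<rho> \<theta> \<alpha> (indicator F) x"
        unfolding frac_maximal_def using r int by (intro SUP_upper2[of "(a, r)"]) (auto simp: Q_def s_def)
      with y(2) show "x \<in> ?E" by simp
    qed
    moreover have "?E \<in> sets lebesgue"
      using open_frac_maximal_superlevel[of \<rho> y \<theta> \<alpha> "indicator F"] \<rho> y(1) by (simp add: borel_open)
    ultimately have "V \<le> epowr (emeasure (weighted \<nu>) ?E) (1 / q)"
      unfolding V_def using q by (intro epowr_mono emeasure_mono) auto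
    then have "ennreal y * V \<le> ennreal y * epowr (emeasure (weighted \<nu>) ?E) (1 / q)"
      by (rule mult_left_mono) simp
    also have "\<dots> \<le> lorentz_weak (ennreal q) (weighted \<nu>) (frac_maximal \<rho> \<theta> \<alpha> (indicator F))"
      using q y(1) by (auto simp: lorentz_weak_ennreal intro!: SUP_upper2[of y])
    also have "\<dots> \<le> ennreal c * lorentz_1 p (weighted \<mu>) (\<lambda>x. ennreal \<bar>indicator F x\<bar>)"
      by (rule weak) measurable
    also have "\<dots> = ennreal (c * p) * epowr (emeasure (weighted \<mu>) F) (1 / p)"
      using lorentz_1_indicator[OF p, of "weighted \<mu>" F] p c by (simp add: ennreal_mult mult.assoc)
    finally show "ennreal y * V \<le> ennreal (c * p) * epowr (emeasure (weighted \<mu>) F) (1 / p)" .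
  qed
  define h where "h x = ennreal (indicator Q x * inverse (\<mu> x))" for x
  have h [measurable]: "h \<in> borel_measurable lebesgue" unfolding h_def by measurable
  \<comment> \<open>Chebyshev's inequality for \<open>h\<close> bounds \<open>t\<close> \<mu>(F) by
    the Lebesgue measure of its superlevel set F. Inserting this into \<open>test\<close> and
    dividing by \<mu>(F)^(1/p) leaves the exponent of the weak norm.\<close>
  have level: "(V / ennreal s) * (ennreal t * epowr (emeasure (weighted \<mu>) {x. ennreal t < h x}) (1 - 1 / p)) \<le> ennreal (c * p)"
    if t: "0 < t" for t
  proof -
    define F where "F = {x. ennreal t < h x}"
    define m where "m = emeasure (weighted \<mu>) F"
    have "{x \<in> space lebesgue. ennreal t < h x} \<in> sets lebesgue" by measurable
    then have F: "F \<in> sets lebesgue" by (simp add: F_def)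
    have FQ: "F \<subseteq> Q" by (auto simp: F_def h_def indicator_def split: if_splits)
    \<comment> \<open>Local integrability of \<mu> makes \<open>m\<close> finite, so a power of it
      can be divided out.\<close>
    have "m \<le> emeasure (weighted \<mu>) Q" unfolding m_def using FQ by (intro emeasure_mono) auto
    also have "\<dots> < top" unfolding Q_def by (rule emeasure_weighted_compact[OF \<mu> compact_cube])
    finally obtain m' where m': "m = ennreal m'" "0 \<le> m'" by (cases m) auto
    have "ennreal t * m = (\<integral>\<^sup>+ x \<in> F. ennreal t \<partial>weighted \<mu>)"
      using F by (simp add: nn_integral_cmult_indicator m_def)
    also have "\<dots> \<le> (\<integral>\<^sup>+ x \<in> F. h x \<partial>weighted \<mu>)"
      by (intro nn_integral_mono) (auto simp: F_def indicator_def)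
    also have "\<dots> = emeasure lebesgue F"
      unfolding h_def by (rule nn_integral_inverse_weighted[OF \<mu> F FQ Q])
    finally have "ennreal t * m / ennreal s * V \<le> emeasure lebesgue F / ennreal s * V"
      by (intro mult_right_mono divide_right_mono_ennreal) auto
    also have "\<dots> \<le> ennreal (c * p) * epowr m (1 / p)"
      unfolding m_def by (rule test[OF F FQ])
    finally have le: "(V / ennreal s) * ennreal t * m \<le> ennreal (c * p) * epowr m (1 / p)"
      by (simp add: divide_ennreal_def ac_simps)
    show ?thesis
    \<comment> \<open>For \<open>m' = 0\<close> the left side is 0, also at \<open>p = 1\<close>,
      since \<open>epowr 0 0 = 0\<close>.\<close>
    proof (cases "m' = 0")
      case False
      with m' have m_pos: "0 < m'" by simp
      let ?i = "ennreal (m' powr (- (1 / p)))"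
      have "?i * ((V / ennreal s) * ennreal t * m) \<le> ?i * (ennreal (c * p) * epowr m (1 / p))"
        using le by (rule mult_left_mono) simp
      moreover have "?i * m = epowr m (1 - 1 / p)"
      proof -
        have "m' powr (- (1 / p)) * m' powr 1 = m' powr (1 - 1 / p)"
          unfolding powr_add[symmetric] by simp
        then show ?thesis using m_pos unfolding m' by (simp add: epowr_ennreal flip: ennreal_mult)
      qed
      moreover have "?i * epowr m (1 / p) = 1"
        using m_pos unfolding m' by (simp add: epowr_ennreal flip: ennreal_mult powr_add)
      ultimately show ?thesis
        unfolding F_def[symmetric] m_def[symmetric]
        by (metis mult.assoc mult.commute mult_1)
    qed (use m' in \<open>simp add: F_def m_def\<close>)
  qed
  have "V * (lorentz_weak (conj_exponent p) (weighted \<mu>) h / ennreal s)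
      = (V / ennreal s) * lorentz_weak (conj_exponent p) (weighted \<mu>) h"
    by (simp add: divide_ennreal_def ac_simps)
  also have "\<dots> \<le> (V / ennreal s) *
      (SUP t \<in> {0<..}. ennreal t * epowr (emeasure (weighted \<mu>) {x. ennreal t < h x}) (1 - 1 / p))"
    using lorentz_weak_conj_exponent_le[OF p, of h "weighted \<mu>"] h by (intro mult_left_mono) auto
  also have "\<dots> \<le> ennreal (c * p)"
    unfolding SUP_mult_left_ennreal using level by (intro SUP_least) auto
  finally show "epowr (emeasure (weighted \<nu>) (cube a r)) (1 / q) *
      (lorentz_weak (conj_exponent p) (weighted \<mu>) (\<lambda>x. ennreal (indicator (cube a r) x * inverse (\<mu> x)))
        / ennreal (scaled_size \<rho> \<theta> \<alpha> a r)) \<le> ennreal (c * p)"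
    unfolding V_def h_def Q_def s_def .
qed

theorem theorem1p9:
  fixes \<theta> \<alpha> p q :: real and \<rho> :: "real^'n \<Rightarrow> real"
  assumes "0 \<le> \<theta>" and "0 \<le> \<alpha>" and "\<alpha> < real CARD('n)"
    and "1 \<le> p" and "p \<le> q"
    and "critical_radius \<rho>"
  shows "(\<forall>\<mu> \<nu> :: real^'n \<Rightarrow> real. weight \<mu> \<longrightarrow> weight \<nu> \<longrightarrow>
           ((\<exists>c::real. 0 < c \<and> (\<forall>f \<in> borel_measurable lebesgue.
               lorentz_weak (ennreal q) (weighted \<nu>) (frac_maximal \<rho> \<theta> \<alpha> f)
                 \<le> ennreal c * lorentz_1 p (weighted \<mu>) (\<lambda>x. ennreal \<bar>f x\<bar>)))
            \<longleftrightarrow> (\<mu>, \<nu>) \<in> A_class \<rho> \<theta> \<alpha> p q))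
       \<and> (\<exists>C::real. 0 < C \<and> (\<forall>\<mu> \<nu> :: real^'n \<Rightarrow> real. weight \<mu> \<longrightarrow> weight \<nu> \<longrightarrow>
            (\<mu>, \<nu>) \<in> A_class \<rho> \<theta> \<alpha> p q \<longrightarrow>
            (\<forall>f \<in> borel_measurable lebesgue.
               lorentz_weak (ennreal q) (weighted \<nu>) (frac_maximal \<rho> \<theta> \<alpha> f)
                 \<le> ennreal C * A_const \<rho> \<theta> \<alpha> p q \<mu> \<nu>
                     * lorentz_1 p (weighted \<mu>) (\<lambda>x. ennreal \<bar>f x\<bar>))))"
proof -
  have \<rho>: "0 < \<rho> x" for x using \<open>critical_radius \<rho>\<close> by (simp add: critical_radius_def)
  \<comment> \<open>The loss in passing from a cube to its fourfold enlargement; it depends on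
    \<theta>, \<alpha> and the dimension alone, hence not on the weights.\<close>
  define C where "C = (4 powr \<theta> * 4 ^ CARD('n)) powr (1 - \<alpha> / real CARD('n))"
  have C: "0 < C" by (simp add: C_def)
  have bound: "lorentz_weak (ennreal q) (weighted \<nu>) (frac_maximal \<rho> \<theta> \<alpha> f)
      \<le> ennreal C * A_const \<rho> \<theta> \<alpha> p q \<mu> \<nu> * lorentz_1 p (weighted \<mu>) (\<lambda>x. ennreal \<bar>f x\<bar>)"
    if "weight \<mu>" "weight \<nu>" "f \<in> borel_measurable lebesgue" for \<mu> \<nu> f
    unfolding C_def using assms \<rho> that by (intro weak_type_bound) auto
  show ?thesis
  proof (intro conjI allI impI iffI)
    fix \<mu> \<nu> :: "real^'n \<Rightarrow> real"
    assume w: "weight \<mu>" "weight \<nu>"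
    assume "\<exists>c::real. 0 < c \<and> (\<forall>f \<in> borel_measurable lebesgue.
        lorentz_weak (ennreal q) (weighted \<nu>) (frac_maximal \<rho> \<theta> \<alpha> f)
          \<le> ennreal c * lorentz_1 p (weighted \<mu>) (\<lambda>x. ennreal \<bar>f x\<bar>))"
    then obtain c where "0 < c" "\<forall>f \<in> borel_measurable lebesgue.
        lorentz_weak (ennreal q) (weighted \<nu>) (frac_maximal \<rho> \<theta> \<alpha> f)
          \<le> ennreal c * lorentz_1 p (weighted \<mu>) (\<lambda>x. ennreal \<bar>f x\<bar>)"
      by blast
    then have "A_const \<rho> \<theta> \<alpha> p q \<mu> \<nu> \<le> ennreal (c * p)"
      using assms \<rho> w by (intro weak_type_necessary) auto
    then show "(\<mu>, \<nu>) \<in> A_class \<rho> \<theta> \<alpha> p q"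
      by (auto simp: A_class_def le_less_trans)
  next
    fix \<mu> \<nu> :: "real^'n \<Rightarrow> real"
    assume w: "weight \<mu>" "weight \<nu>" and "(\<mu>, \<nu>) \<in> A_class \<rho> \<theta> \<alpha> p q"
    then obtain A where A: "A_const \<rho> \<theta> \<alpha> p q \<mu> \<nu> = ennreal A" "0 \<le> A"
      by (cases "A_const \<rho> \<theta> \<alpha> p q \<mu> \<nu>") (auto simp: A_class_def)
    \<comment> \<open>Adding 1 keeps the constant positive when \<open>A = 0\<close>.\<close>
    have "ennreal C * ennreal A \<le> ennreal (C * A + 1)"
      using A C by (simp flip: ennreal_mult)
    then have "lorentz_weak (ennreal q) (weighted \<nu>) (frac_maximal \<rho> \<theta> \<alpha> f)
        \<le> ennreal (C * A + 1) * lorentz_1 p (weighted \<mu>) (\<lambda>x. ennreal \<bar>f x\<bar>)"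
      if "f \<in> borel_measurable lebesgue" for f
      using bound[OF w that] unfolding A(1) by (meson mult_right_mono order_trans zero_le)
    moreover have "0 < C * A + 1" using A C by (simp add: add_nonneg_pos)
    ultimately show "\<exists>c::real. 0 < c \<and> (\<forall>f \<in> borel_measurable lebesgue.
        lorentz_weak (ennreal q) (weighted \<nu>) (frac_maximal \<rho> \<theta> \<alpha> f)
          \<le> ennreal c * lorentz_1 p (weighted \<mu>) (\<lambda>x. ennreal \<bar>f x\<bar>))"
      by blast
  qed (use bound C in blast)
qed

end
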